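(* Let $V$ be a finite set, $R=\mathbb C^q$ with primitive idempotents $\varepsilon_1,\dots,\varepsilon_q$, and let $w_{ij}=w_{ji}=\sum_{\alpha=1}^q\gamma_{ij}^{(\alpha)}\varepsilon_\alpha\in\mathbb C^q$ be symmetric weights with $w_{ii}=0$ such that the bracket $[f,g]_i=\sum_j w_{ij}(f_ig_j-f_jg_i)$ on $\mathfrak g=R^V$ and the canonical cobracket $\delta(e_i)=\sum_j w_{ij}\,e_i\wedge e_j$ form a Lie bialgebra over $R$. For each $\alpha$ let $M_\alpha=\{\{i,j\}:\gamma_{ij}^{(\alpha)}\neq0\}$ (a matching) and let $I_\alpha\subseteq V$ be the set of vertices not covered by $M_\alpha$. Regard $\mathfrak g$ as a complex Lie algebra through the diagonal embedding $\mathbb C\hookrightarrow\mathbb C^q$, $\lambda\mapsto(\lambda,\dots,\lambda)$. Then there is an isomorphism of complex Lie algebras $$\mathfrak g\;\cong\;\bigoplus_{\alpha=1}^q\Bigl(\bigoplus_{\{i,j\}\in M_\alpha}\mathfrak{aff}(1)_{ij}\;\oplus\;\mathbb C^{|I_\alpha|}\Bigr),$$ where each $\mathfrak{aff}(1)_{ij}$ is a copy of $\mathfrak{aff}(1)$ and each $\mathbb C^{|I_\alpha|}$ is abelian, and the complex dimension is $\sum_{\alpha=1}^q(2|M_\alpha|+|I_\alpha|)=q|V|$. Hence $[\mathfrak g,\mathfrak g]$ is abelian, i.e. $\mathfrak g$ is metabelian, and $\mathfrak g$ is nonnilpotent whenever at least one weight $w_{ij}$ is nonzero.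
   Context: $\mathfrak{aff}(1)$ denotes the two-dimensional nonabelian complex Lie algebra. $\{e_i\}_{i\in V}$ is the coordinate basis of $R^V$; $\delta:\mathfrak g\to\bigwedge^2_R\mathfrak g$ is extended $R$-linearly. "Lie bialgebra over $R$" is in the finite free module sense: the bracket satisfies the Jacobi identity; $\delta$ satisfies co-Jacobi, i.e. the induced bracket on $\mathfrak g^*$, $\langle[\xi,\eta]^*,x\rangle=\langle\xi\wedge\eta,\delta(x)\rangle$ with $\langle\xi\wedge\eta,u\wedge v\rangle=\xi(u)\eta(v)-\xi(v)\eta(u)$, satisfies the Jacobi identity; and $\delta([x,y])=\operatorname{ad}^{(2)}_x\delta(y)-\operatorname{ad}^{(2)}_y\delta(x)$ for all $x,y$, where $\operatorname{ad}^{(2)}_x(u\wedge v)=[x,u]\wedge v+u\wedge[x,v]$. For $R=\mathbb C^q$ this is equivalent to $w_{ij}w_{ik}=0$ for all $i$ and all $j\ne k$, i.e. to every $M_\alpha$ being a matching. *)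

theory Defs
  imports "HOL-Analysis.Analysis" "HOL-Library.Function_Algebras"
begin

section \<open>Lie algebras over commutative rings\<close>

text \<open>A Lie algebra lives on a submodule \<open>lie_carrier\<close> of an ambient module whose addition comes
  from the type class; only the values of the bracket on the carrier matter.\<close>

record ('k, 'a) lie =
  lie_carrier :: "'a set"
  lie_scale :: "'k \<Rightarrow> 'a \<Rightarrow> 'a"
  lie_bracket :: "'a \<Rightarrow> 'a \<Rightarrow> 'a"

locale lie_algebra = module "lie_scale L"
  for L :: "('k::comm_ring_1, 'a::ab_group_add) lie" +
  assumes subspace_carrier: "subspace (lie_carrier L)"
    and bracket_closed: "\<lbrakk>x \<in> lie_carrier L; y \<in> lie_carrier L\<rbrakk> \<Longrightarrow> lie_bracket L x y \<in> lie_carrier L"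
    and bracket_add_left: "\<lbrakk>x \<in> lie_carrier L; y \<in> lie_carrier L; z \<in> lie_carrier L\<rbrakk> \<Longrightarrow>
      lie_bracket L (x + y) z = lie_bracket L x z + lie_bracket L y z"
    and bracket_add_right: "\<lbrakk>x \<in> lie_carrier L; y \<in> lie_carrier L; z \<in> lie_carrier L\<rbrakk> \<Longrightarrow>
      lie_bracket L x (y + z) = lie_bracket L x y + lie_bracket L x z"
    and bracket_scale_left: "\<lbrakk>x \<in> lie_carrier L; y \<in> lie_carrier L\<rbrakk> \<Longrightarrow>
      lie_bracket L (lie_scale L c x) y = lie_scale L c (lie_bracket L x y)"
    and bracket_scale_right: "\<lbrakk>x \<in> lie_carrier L; y \<in> lie_carrier L\<rbrakk> \<Longrightarrow>
      lie_bracket L x (lie_scale L c y) = lie_scale L c (lie_bracket L x y)"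
    and bracket_alternating: "x \<in> lie_carrier L \<Longrightarrow> lie_bracket L x x = 0"
    and bracket_jacobi: "\<lbrakk>x \<in> lie_carrier L; y \<in> lie_carrier L; z \<in> lie_carrier L\<rbrakk> \<Longrightarrow>
      lie_bracket L (lie_bracket L x y) z + lie_bracket L (lie_bracket L y z) x
        + lie_bracket L (lie_bracket L z x) y = 0"

definition lie_iso ::
  "('k::comm_ring_1, 'a::ab_group_add) lie \<Rightarrow> ('k, 'b::ab_group_add) lie \<Rightarrow> ('a \<Rightarrow> 'b) \<Rightarrow> bool" where
  "lie_iso L L' \<phi> \<longleftrightarrow>
     bij_betw \<phi> (lie_carrier L) (lie_carrier L') \<and>
     (\<forall>x\<in>lie_carrier L. \<forall>y\<in>lie_carrier L. \<phi> (x + y) = \<phi> x + \<phi> y) \<and>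
     (\<forall>c. \<forall>x\<in>lie_carrier L. \<phi> (lie_scale L c x) = lie_scale L' c (\<phi> x)) \<and>
     (\<forall>x\<in>lie_carrier L. \<forall>y\<in>lie_carrier L.
        \<phi> (lie_bracket L x y) = lie_bracket L' (\<phi> x) (\<phi> y))"

definition lie_isomorphic ::
  "('k::comm_ring_1, 'a::ab_group_add) lie \<Rightarrow> ('k, 'b::ab_group_add) lie \<Rightarrow> bool" where
  "lie_isomorphic L L' \<longleftrightarrow> lie_algebra L \<and> lie_algebra L' \<and> (\<exists>\<phi>. lie_iso L L' \<phi>)"

definition lie_dim :: "('k::field, 'a::ab_group_add) lie \<Rightarrow> nat" where
  "lie_dim L = vector_space.dim (lie_scale L) (lie_carrier L)"

text \<open>The submodule \<open>[A, B]\<close> spanned by the brackets of elements of \<open>A\<close> and \<open>B\<close>.\<close>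

definition bracket_span ::
  "('k::comm_ring_1, 'a::ab_group_add) lie \<Rightarrow> 'a set \<Rightarrow> 'a set \<Rightarrow> 'a set" where
  "bracket_span L A B = module.span (lie_scale L) {lie_bracket L x y |x y. x \<in> A \<and> y \<in> B}"

definition derived_algebra :: "('k::comm_ring_1, 'a::ab_group_add) lie \<Rightarrow> 'a set" where
  "derived_algebra L = bracket_span L (lie_carrier L) (lie_carrier L)"

definition metabelian :: "('k::comm_ring_1, 'a::ab_group_add) lie \<Rightarrow> bool" where
  "metabelian L \<longleftrightarrow>
     (\<forall>x\<in>derived_algebra L. \<forall>y\<in>derived_algebra L. lie_bracket L x y = 0)"

primrec lower_central :: "('k::comm_ring_1, 'a::ab_group_add) lie \<Rightarrow> nat \<Rightarrow> 'a set" where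
  "lower_central L 0 = lie_carrier L"
| "lower_central L (Suc n) = bracket_span L (lie_carrier L) (lower_central L n)"

definition lie_nilpotent :: "('k::comm_ring_1, 'a::ab_group_add) lie \<Rightarrow> bool" where
  "lie_nilpotent L \<longleftrightarrow> (\<exists>n. lower_central L n = {0})"

definition restrict_scalars :: "('l \<Rightarrow> 'k) \<Rightarrow> ('k, 'a) lie \<Rightarrow> ('l, 'a) lie" where
  "restrict_scalars h L =
     \<lparr>lie_carrier = lie_carrier L, lie_scale = (\<lambda>c. lie_scale L (h c)), lie_bracket = lie_bracket L\<rparr>"

definition lie_prod :: "('k, 'a) lie \<Rightarrow> ('k, 'b) lie \<Rightarrow> ('k, 'a \<times> 'b) lie" where
  "lie_prod L L' =
     \<lparr>lie_carrier = lie_carrier L \<times> lie_carrier L',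
      lie_scale = (\<lambda>c (x, y). (lie_scale L c x, lie_scale L' c y)),
      lie_bracket = (\<lambda>(x, y) (x', y'). (lie_bracket L x x', lie_bracket L' y y'))\<rparr>"

text \<open>Families are extended by zero outside \<open>I\<close>. The index sets used below are finite, so there is no
  difference between direct sum and direct product.\<close>

definition lie_dsum :: "'i set \<Rightarrow> ('i \<Rightarrow> ('k, 'a::zero) lie) \<Rightarrow> ('k, 'i \<Rightarrow> 'a) lie" where
  "lie_dsum I L =
     \<lparr>lie_carrier = {f. (\<forall>i\<in>I. f i \<in> lie_carrier (L i)) \<and> (\<forall>i. i \<notin> I \<longrightarrow> f i = 0)},
      lie_scale = (\<lambda>c f i. lie_scale (L i) c (f i)),
      lie_bracket = (\<lambda>f g i. if i \<in> I then lie_bracket (L i) (f i) (g i) else 0)\<rparr>"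

section \<open>The free module on a finite set and its exterior square\<close>

text \<open>\<open>R\<^sup>V\<close> consists of the functions vanishing outside \<open>V\<close>.\<close>

definition coord_module :: "'v set \<Rightarrow> ('v \<Rightarrow> 'r::zero) set" where
  "coord_module V = {f. \<forall>i. i \<notin> V \<longrightarrow> f i = 0}"

definition coord_scale :: "'r \<Rightarrow> ('v \<Rightarrow> 'r) \<Rightarrow> 'v \<Rightarrow> 'r::times" where
  "coord_scale c f = (\<lambda>i. c * f i)"

definition basis_vec :: "'v \<Rightarrow> 'v \<Rightarrow> 'r::zero_neq_one" where
  "basis_vec k = (\<lambda>i. if i = k then 1 else 0)"

definition coord_lie ::
  "'v set \<Rightarrow> (('v \<Rightarrow> 'r) \<Rightarrow> ('v \<Rightarrow> 'r) \<Rightarrow> 'v \<Rightarrow> 'r) \<Rightarrow> ('r::comm_ring_1, 'v \<Rightarrow> 'r) lie" where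
  "coord_lie V br = \<lparr>lie_carrier = coord_module V, lie_scale = coord_scale, lie_bracket = br\<rparr>"

definition abelian_lie :: "'v set \<Rightarrow> ('r::comm_ring_1, 'v \<Rightarrow> 'r) lie" where
  "abelian_lie I = coord_lie I (\<lambda>f g. 0)"

text \<open>Since \<open>R\<^sup>V\<close> is free on the \<open>basis_vec i\<close>, its exterior square is free on their wedges over
  unordered pairs. It is realised as the module of alternating matrices, where \<open>T i j\<close> is the
  coefficient of \<open>e\<^sub>i \<and> e\<^sub>j\<close>.\<close>

definition ext_square :: "'v set \<Rightarrow> ('v \<Rightarrow> 'v \<Rightarrow> 'r::comm_ring_1) set" where
  "ext_square V = {T. (\<forall>i. T i i = 0) \<and> (\<forall>i j. T i j = - T j i) \<and> (\<forall>i j. i \<notin> V \<longrightarrow> T i j = 0)}"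

definition ext_scale :: "'r \<Rightarrow> ('v \<Rightarrow> 'v \<Rightarrow> 'r) \<Rightarrow> 'v \<Rightarrow> 'v \<Rightarrow> 'r::times" where
  "ext_scale c T = (\<lambda>i j. c * T i j)"

definition wedge :: "('v \<Rightarrow> 'r) \<Rightarrow> ('v \<Rightarrow> 'r) \<Rightarrow> 'v \<Rightarrow> 'v \<Rightarrow> 'r::comm_ring_1" where
  "wedge u v = (\<lambda>i j. u i * v j - u j * v i)"

text \<open>The pairing with \<open>\<xi> \<and> \<eta>\<close> and the operator \<open>ad\<^sup>(\<^sup>2\<^sup>)\<^sub>x\<close> are written on coordinates;
  \<open>wedge_pairing_wedge\<close>, \<open>ad2_wedge\<close> and \<open>ext_square_eq_span\<close> below show that they are the linear
  extensions of the usual formulas on \<open>u \<and> v\<close>.\<close>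

definition wedge_pairing ::
  "'v set \<Rightarrow> (('v \<Rightarrow> 'r) \<Rightarrow> 'r) \<Rightarrow> (('v \<Rightarrow> 'r) \<Rightarrow> 'r) \<Rightarrow> ('v \<Rightarrow> 'v \<Rightarrow> 'r) \<Rightarrow> 'r::comm_ring_1" where
  "wedge_pairing V \<xi> \<eta> T = (\<Sum>i\<in>V. \<Sum>j\<in>V. T i j * \<xi> (basis_vec i) * \<eta> (basis_vec j))"

definition ad2 ::
  "'v set \<Rightarrow> (('v \<Rightarrow> 'r) \<Rightarrow> ('v \<Rightarrow> 'r) \<Rightarrow> 'v \<Rightarrow> 'r) \<Rightarrow> ('v \<Rightarrow> 'r)
    \<Rightarrow> ('v \<Rightarrow> 'v \<Rightarrow> 'r) \<Rightarrow> 'v \<Rightarrow> 'v \<Rightarrow> 'r::comm_ring_1" where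
  "ad2 V br x T =
     (\<lambda>i j. \<Sum>k\<in>V. br x (basis_vec k) i * T k j + T i k * br x (basis_vec k) j)"

definition dual_module :: "'v set \<Rightarrow> (('v \<Rightarrow> 'r) \<Rightarrow> 'r::comm_ring_1) set" where
  "dual_module V = {\<xi>.
     (\<forall>f\<in>coord_module V. \<forall>g\<in>coord_module V. \<xi> (f + g) = \<xi> f + \<xi> g) \<and>
     (\<forall>c. \<forall>f\<in>coord_module V. \<xi> (coord_scale c f) = c * \<xi> f)}"

section \<open>Lie bialgebras\<close>

definition dual_bracket ::
  "'v set \<Rightarrow> (('v \<Rightarrow> 'r) \<Rightarrow> 'v \<Rightarrow> 'v \<Rightarrow> 'r) \<Rightarrow> (('v \<Rightarrow> 'r) \<Rightarrow> 'r) \<Rightarrow> (('v \<Rightarrow> 'r) \<Rightarrow> 'r)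
    \<Rightarrow> ('v \<Rightarrow> 'r) \<Rightarrow> 'r::comm_ring_1" where
  "dual_bracket V \<delta> \<xi> \<eta> = (\<lambda>x. wedge_pairing V \<xi> \<eta> (\<delta> x))"

definition is_cobracket :: "'v set \<Rightarrow> (('v \<Rightarrow> 'r) \<Rightarrow> 'v \<Rightarrow> 'v \<Rightarrow> 'r::comm_ring_1) \<Rightarrow> bool" where
  "is_cobracket V \<delta> \<longleftrightarrow>
     (\<forall>x\<in>coord_module V. \<delta> x \<in> ext_square V) \<and>
     (\<forall>x\<in>coord_module V. \<forall>y\<in>coord_module V. \<delta> (x + y) = \<delta> x + \<delta> y) \<and>
     (\<forall>c. \<forall>x\<in>coord_module V. \<delta> (coord_scale c x) = ext_scale c (\<delta> x))"

definition co_jacobi :: "'v set \<Rightarrow> (('v \<Rightarrow> 'r) \<Rightarrow> 'v \<Rightarrow> 'v \<Rightarrow> 'r::comm_ring_1) \<Rightarrow> bool" where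
  "co_jacobi V \<delta> \<longleftrightarrow>
     (\<forall>\<xi>\<in>dual_module V. \<forall>\<eta>\<in>dual_module V. \<forall>\<zeta>\<in>dual_module V. \<forall>x\<in>coord_module V.
        dual_bracket V \<delta> (dual_bracket V \<delta> \<xi> \<eta>) \<zeta> x + dual_bracket V \<delta> (dual_bracket V \<delta> \<eta> \<zeta>) \<xi> x
          + dual_bracket V \<delta> (dual_bracket V \<delta> \<zeta> \<xi>) \<eta> x = 0)"

definition lie_bialgebra ::
  "'v set \<Rightarrow> (('v \<Rightarrow> 'r) \<Rightarrow> ('v \<Rightarrow> 'r) \<Rightarrow> 'v \<Rightarrow> 'r)
    \<Rightarrow> (('v \<Rightarrow> 'r) \<Rightarrow> 'v \<Rightarrow> 'v \<Rightarrow> 'r::comm_ring_1) \<Rightarrow> bool" where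
  "lie_bialgebra V br \<delta> \<longleftrightarrow>
     lie_algebra (coord_lie V br) \<and> is_cobracket V \<delta> \<and> co_jacobi V \<delta> \<and>
     (\<forall>x\<in>coord_module V. \<forall>y\<in>coord_module V.
        \<delta> (br x y) = ad2 V br x (\<delta> y) - ad2 V br y (\<delta> x))"

section \<open>Weighted graphs\<close>

definition weight_bracket ::
  "'v set \<Rightarrow> ('v \<Rightarrow> 'v \<Rightarrow> 'r) \<Rightarrow> ('v \<Rightarrow> 'r) \<Rightarrow> ('v \<Rightarrow> 'r) \<Rightarrow> 'v \<Rightarrow> 'r::comm_ring_1" where
  "weight_bracket V w f g = (\<lambda>i. \<Sum>j\<in>V. w i j * (f i * g j - f j * g i))"

text \<open>The linear extension of \<open>\<delta>(e\<^sub>i) = \<Sum>\<^sub>j w\<^sub>i\<^sub>j e\<^sub>i \<and> e\<^sub>j\<close>, cf. \<open>weight_cobracket_basis_vec\<close>.\<close>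

definition weight_cobracket ::
  "'v set \<Rightarrow> ('v \<Rightarrow> 'v \<Rightarrow> 'r) \<Rightarrow> ('v \<Rightarrow> 'r) \<Rightarrow> 'v \<Rightarrow> 'v \<Rightarrow> 'r::comm_ring_1" where
  "weight_cobracket V w f =
     (\<Sum>i\<in>V. ext_scale (f i) (\<Sum>j\<in>V. ext_scale (w i j) (wedge (basis_vec i) (basis_vec j))))"

text \<open>The ring \<open>\<complex>\<^sup>q\<close> is \<open>complex ^ 'q\<close> with componentwise multiplication; its primitive idempotents are
  \<open>axis \<alpha> 1\<close>, and \<open>w i j $ \<alpha>\<close> is the coefficient of \<open>axis \<alpha> 1\<close> in \<open>w i j\<close>.\<close>

definition support_edges :: "'v set \<Rightarrow> ('v \<Rightarrow> 'v \<Rightarrow> complex ^ 'q) \<Rightarrow> 'q \<Rightarrow> 'v set set" where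
  "support_edges V w \<alpha> = {{i, j} |i j. i \<in> V \<and> j \<in> V \<and> w i j $ \<alpha> \<noteq> 0}"

definition uncovered :: "'v set \<Rightarrow> ('v \<Rightarrow> 'v \<Rightarrow> complex ^ 'q) \<Rightarrow> 'q \<Rightarrow> 'v set" where
  "uncovered V w \<alpha> = V - \<Union>(support_edges V w \<alpha>)"

definition is_matching :: "'v set set \<Rightarrow> bool" where
  "is_matching M \<longleftrightarrow> (\<forall>e\<in>M. card e = 2) \<and> pairwise disjnt M"

text \<open>The coordinate module with \<open>weight_bracket\<close>, viewed over the complex numbers along the diagonal
  embedding \<open>vec\<close>.\<close>

definition complex_weight_lie ::
  "'v set \<Rightarrow> ('v \<Rightarrow> 'v \<Rightarrow> complex ^ 'q) \<Rightarrow> (complex, 'v \<Rightarrow> complex ^ 'q) lie" where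
  "complex_weight_lie V w = restrict_scalars vec (coord_lie V (weight_bracket V w))"

text \<open>The nonabelian Lie algebra with basis \<open>x = (1, 0)\<close>, \<open>y = (0, 1)\<close> and \<open>[x, y] = y\<close>;
  \<open>aff1_unique\<close> below identifies it as the two-dimensional nonabelian complex Lie algebra.\<close>

definition aff1 :: "(complex, complex \<times> complex) lie" where
  "aff1 = \<lparr>lie_carrier = UNIV, lie_scale = (\<lambda>c (a, b). (c * a, c * b)),
     lie_bracket = (\<lambda>(a, b) (a', b'). (0, a * b' - b * a'))\<rparr>"

section \<open>Agreement with the coordinate-free descriptions\<close>

lemma module_ext_scale: "module (ext_scale :: 'r::comm_ring_1 \<Rightarrow> _ \<Rightarrow> 'v \<Rightarrow> 'v \<Rightarrow> 'r)"
  by unfold_locales (auto simp: ext_scale_def fun_eq_iff algebra_simps)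

lemma sum_fun_apply: "(\<Sum>i\<in>A. F i) x = (\<Sum>i\<in>A. F i x)"
  for F :: "'i \<Rightarrow> 'a \<Rightarrow> 'b::comm_monoid_add"
  by (induction A rule: infinite_finite_induct) auto

lemma coord_expansion:
  fixes u :: "'v \<Rightarrow> 'r::comm_ring_1"
  assumes "finite V" "u \<in> coord_module V"
  shows "u = (\<Sum>i\<in>V. coord_scale (u i) (basis_vec i))"
proof
  fix k
  have "(\<Sum>i\<in>V. coord_scale (u i) (basis_vec i)) k = (\<Sum>i\<in>V. if i = k then u k else 0)"
    unfolding sum_fun_apply
    by (rule sum.cong) (auto simp: coord_scale_def basis_vec_def)
  then show "u k = (\<Sum>i\<in>V. coord_scale (u i) (basis_vec i)) k"
    using assms by (auto simp: coord_module_def)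
qed

lemma coord_scale_basis_in: "i \<in> V \<Longrightarrow> coord_scale c (basis_vec i) \<in> coord_module V"
  for c :: "'r::comm_ring_1"
  by (auto simp: coord_module_def coord_scale_def basis_vec_def)

lemma coord_sum_in: "(\<And>i. i \<in> A \<Longrightarrow> F i \<in> coord_module V) \<Longrightarrow> sum F A \<in> coord_module V"
  for F :: "'i \<Rightarrow> 'v \<Rightarrow> 'r::comm_ring_1"
  unfolding coord_module_def by (auto simp: sum_fun_apply intro!: sum.neutral)

lemma dual_module_expansion:
  assumes "finite V" "\<xi> \<in> dual_module V" "u \<in> coord_module V"
  shows "\<xi> u = (\<Sum>i\<in>V. u i * \<xi> (basis_vec i))"
proof -
  have add: "\<And>f g. f \<in> coord_module V \<Longrightarrow> g \<in> coord_module V \<Longrightarrow> \<xi> (f + g) = \<xi> f + \<xi> g"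
    and sc: "\<And>c f. f \<in> coord_module V \<Longrightarrow> \<xi> (coord_scale c f) = c * \<xi> f"
    using assms(2) by (auto simp: dual_module_def)
  have zero_in: "(0 :: 'a \<Rightarrow> 'b) \<in> coord_module V" by (simp add: coord_module_def)
  have zero: "\<xi> 0 = 0" using add[OF zero_in zero_in] by simp
  have bv: "(basis_vec i :: 'a \<Rightarrow> 'b) \<in> coord_module V" if "i \<in> V" for i
    using that by (auto simp: coord_module_def basis_vec_def)
  have "\<xi> (\<Sum>i\<in>A. coord_scale (u i) (basis_vec i)) = (\<Sum>i\<in>A. u i * \<xi> (basis_vec i))"
    if "A \<subseteq> V" for A
    using finite_subset[OF that assms(1)] that
  proof (induction A rule: finite_induct)
    case (insert i A)
    have "(\<Sum>i\<in>A. coord_scale (u i) (basis_vec i)) \<in> coord_module V"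
      using insert.prems by (intro coord_sum_in coord_scale_basis_in) auto
    from add[OF coord_scale_basis_in this, of i "u i"] show ?case
      using insert sc[OF bv, of i "u i"] by (auto simp: plus_fun_def)
  qed (simp add: zero)
  from this[OF subset_refl] show ?thesis
    using coord_expansion[OF assms(1,3)] by simp
qed

lemma wedge_pairing_wedge:
  assumes "finite V" "\<xi> \<in> dual_module V" "\<eta> \<in> dual_module V" "u \<in> coord_module V" "v \<in> coord_module V"
  shows "wedge_pairing V \<xi> \<eta> (wedge u v) = \<xi> u * \<eta> v - \<xi> v * \<eta> u"
  unfolding wedge_pairing_def wedge_def dual_module_expansion[OF assms(1,2,4)]
    dual_module_expansion[OF assms(1,3,4)] dual_module_expansion[OF assms(1,2,5)]
    dual_module_expansion[OF assms(1,3,5)] sum_product sum_subtractf[symmetric]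
  by (intro sum.cong) (auto simp: algebra_simps)

lemma ad2_wedge:
  assumes "finite V" "lie_algebra (coord_lie V br)"
    and "x \<in> coord_module V" "u \<in> coord_module V" "v \<in> coord_module V"
  shows "ad2 V br x (wedge u v) = wedge (br x u) v + wedge u (br x v)"
proof -
  interpret lie_algebra "coord_lie V br" by fact
  have dual: "(\<lambda>y. br x y i) \<in> dual_module V" for i
    unfolding dual_module_def
    using bracket_add_right[of x] bracket_scale_right[of x] assms(3)
    by (auto simp: coord_lie_def coord_scale_def)
  have E: "br x y i = (\<Sum>k\<in>V. y k * br x (basis_vec k) i)" if "y \<in> coord_module V" for y i
    using dual_module_expansion[OF assms(1) dual that] by simp
  show ?thesis
    unfolding fun_eq_iff ad2_def wedge_def plus_fun_apply E[OF assms(4)] E[OF assms(5)]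
    by (simp add: sum_distrib_left sum_distrib_right sum_subtractf[symmetric]
        sum.distrib[symmetric] algebra_simps)
qed

lemma ext_square_eq_span:
  assumes "finite V"
  shows "ext_square V = module.span ext_scale
           {wedge u v |u v. u \<in> coord_module V \<and> v \<in> (coord_module V :: ('v \<Rightarrow> 'r::comm_ring_1) set)}"
    (is "_ = module.span _ ?W")
proof
  interpret E: module "ext_scale :: 'r \<Rightarrow> _ \<Rightarrow> 'v \<Rightarrow> 'v \<Rightarrow> 'r" by (rule module_ext_scale)
  have "E.subspace (ext_square V :: ('v \<Rightarrow> 'v \<Rightarrow> 'r) set)"
  proof (rule E.subspaceI)
    fix S T :: "'v \<Rightarrow> 'v \<Rightarrow> 'r" and c :: 'r
    assume "T \<in> ext_square V"
    then have T: "T i i = 0" "T i j = - T j i" "i \<notin> V \<Longrightarrow> T i j = 0" for i j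
      unfolding ext_square_def by blast+
    have "c * T i j = - (c * T j i)" for i j using T(2)[of i j] by simp
    with T(1,3) show "ext_scale c T \<in> ext_square V"
      unfolding ext_square_def ext_scale_def
      by (intro CollectI conjI allI impI) (metis mult_zero_right)+
    assume "S \<in> ext_square V"
    then have S: "S i i = 0" "S i j = - S j i" "i \<notin> V \<Longrightarrow> S i j = 0" for i j
      unfolding ext_square_def by blast+
    have "S i j + T i j = - (S j i + T j i)" for i j using S(2)[of i j] T(2)[of i j] by simp
    with S(1,3) T(1,3) show "S + T \<in> ext_square V"
      unfolding ext_square_def plus_fun_apply
      by (intro CollectI conjI allI impI) (metis add_0)+
  qed (simp add: ext_square_def)
  moreover have "?W \<subseteq> ext_square V"
    by (auto simp: ext_square_def wedge_def coord_module_def)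
  ultimately show "E.span ?W \<subseteq> ext_square V"
    by (intro E.span_minimal)
  show "ext_square V \<subseteq> E.span ?W"
    using assms
  proof (induction V rule: finite_induct)
    case empty
    have "T = 0" if "T \<in> ext_square {}" for T :: "'v \<Rightarrow> 'v \<Rightarrow> 'r"
    proof (intro ext)
      fix i j
      from that have "T i j = 0" unfolding ext_square_def by blast
      then show "T i j = 0 i j" by simp
    qed
    then show ?case using E.span_zero by blast
  next
    case (insert a V)
    let ?W = "\<lambda>V. {wedge u v |u v. u \<in> coord_module V \<and> v \<in> (coord_module V :: ('v \<Rightarrow> 'r) set)}"
    have mono: "?W V \<subseteq> ?W (insert a V)"
      by (auto simp: coord_module_def)
    show ?case
    proof
      fix T :: "'v \<Rightarrow> 'v \<Rightarrow> 'r"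
      assume T: "T \<in> ext_square (insert a V)"
      have d: "T i i = 0" and s: "T i j = - T j i" and z: "i \<noteq> a \<Longrightarrow> i \<notin> V \<Longrightarrow> T i j = 0" for i j
        using T unfolding ext_square_def by blast+
      have z': "j \<noteq> a \<Longrightarrow> j \<notin> V \<Longrightarrow> T i j = 0" for i j
        using z[of j i] by (simp add: s[of i j])
      let ?U = "wedge (basis_vec a) (T a)"
      have "basis_vec a \<in> (coord_module (insert a V) :: ('v \<Rightarrow> 'r) set)"
        "T a \<in> coord_module (insert a V)"
        using z' by (auto simp: coord_module_def basis_vec_def)
      then have "?U \<in> ?W (insert a V)" by blast
      then have U: "?U \<in> E.span (?W (insert a V))" by (rule E.span_base)
      have "T - ?U \<in> ext_square V"
        unfolding ext_square_def
      proof (intro CollectI conjI allI impI)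
        fix i j
        show "(T - ?U) i i = 0" using d by (simp add: wedge_def)
        show "(T - ?U) i j = - (T - ?U) j i" by (simp add: wedge_def s[of j i])
        assume "i \<notin> V"
        then show "(T - ?U) i j = 0"
          using z[of i j] z'[of i a] d[of a] s[of i a]
          by (cases "i = a") (auto simp: wedge_def basis_vec_def)
      qed
      then have "T - ?U \<in> E.span (?W (insert a V))"
        using insert.IH E.span_mono[OF mono] by blast
      from E.span_add[OF this U] show "T \<in> E.span (?W (insert a V))" by simp
    qed
  qed
qed

lemma weight_cobracket_basis_vec:
  assumes "finite V" "i \<in> V"
  shows "weight_cobracket V w (basis_vec i) =
    (\<Sum>j\<in>V. ext_scale (w i j) (wedge (basis_vec i) (basis_vec j)))"
proof -
  have "ext_scale (basis_vec i k) T = (if k = i then T else 0)" for k and T :: "'a \<Rightarrow> 'a \<Rightarrow> 'b"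
    by (auto simp: ext_scale_def basis_vec_def fun_eq_iff)
  then show ?thesis
    using assms by (simp add: weight_cobracket_def)
qed

lemma axis_expansion: "c = (\<Sum>\<alpha>\<in>UNIV. vec (c $ \<alpha>) * axis \<alpha> 1)" for c :: "complex ^ 'q"
  by (simp add: vec_eq_iff axis_def if_distrib[of "(*) _"] cong: if_cong)

lemma lie_algebra_aff1: "lie_algebra aff1"
proof -
  interpret module "lie_scale aff1"
    by unfold_locales (auto simp: aff1_def algebra_simps)
  show ?thesis
    by unfold_locales (unfold subspace_def, auto simp: aff1_def algebra_simps zero_prod_def)
qed

lemma aff1_nonabelian: "lie_bracket aff1 (1, 0) (0, 1) \<noteq> 0"
  by (simp add: aff1_def zero_prod_def)

lemma vector_space_lie_algebra: "lie_algebra L \<Longrightarrow> vector_space (lie_scale L)"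
  for L :: "('k::field, 'a::ab_group_add) lie"
  by (simp add: lie_algebra_def vector_space_def module_def)

lemma lie_dim_aff1: "lie_dim aff1 = 2"
proof -
  interpret vector_space "lie_scale aff1"
    by (rule vector_space_lie_algebra[OF lie_algebra_aff1])
  let ?B = "{(1, 0), (0, 1)} :: (complex \<times> complex) set"
  have "independent ?B"
    by (auto simp: independent_insert span_singleton) (auto simp: aff1_def zero_prod_def)
  moreover have "span ?B = UNIV"
  proof (intro set_eqI iffI UNIV_I)
    fix p :: "complex \<times> complex"
    have "p = lie_scale aff1 (fst p) (1, 0) + lie_scale aff1 (snd p) (0, 1)"
      by (simp add: aff1_def prod_eq_iff)
    then show "p \<in> span ?B"
      by (metis insertCI span_add span_base span_scale)
  qed
  ultimately have "dim (UNIV :: (complex \<times> complex) set) = card ?B"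
    by (intro dim_eq_card) simp_all
  then show ?thesis by (simp add: lie_dim_def aff1_def)
qed

lemma aff1_unique:
  fixes L :: "(complex, 'a::ab_group_add) lie"
  assumes L: "lie_algebra L" and dim: "lie_dim L = 2"
    and nonabelian: "\<exists>x\<in>lie_carrier L. \<exists>y\<in>lie_carrier L. lie_bracket L x y \<noteq> 0"
  shows "lie_isomorphic aff1 L"
proof -
  interpret lie_algebra L by fact
  interpret vector_space "lie_scale L" by (rule vector_space_lie_algebra[OF L])
  let ?C = "lie_carrier L"
  note sub = subspace_carrier
  have span_pair: "span {u, v} = ?C"
    if "u \<in> ?C" "v \<in> ?C" "independent {u, v}" "u \<noteq> v" for u v
  proof -
    obtain B where B: "B \<subseteq> ?C" "?C \<subseteq> span B" "card B = 2"
      using basis_exists[of ?C] dim by (metis lie_dim_def)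
    then have "finite B" "{u, v} \<subseteq> span B"
      using that by (auto intro: card_ge_0_finite)
    have "?C \<subseteq> span {u, v}"
    proof
      fix z assume "z \<in> ?C"
      show "z \<in> span {u, v}"
      proof (rule ccontr)
        assume z: "z \<notin> span {u, v}"
        then have "independent (insert z {u, v})" using that(3) by (rule independent_insertI)
        moreover have "insert z {u, v} \<subseteq> span B" using \<open>{u, v} \<subseteq> span B\<close> \<open>z \<in> ?C\<close> B by auto
        ultimately have "card (insert z {u, v}) \<le> card B"
          using independent_span_bound[OF \<open>finite B\<close>] by blast
        moreover have "z \<noteq> u" "z \<noteq> v" using z span_base by auto
        ultimately show False using B(3) that(4) by simp
      qed
    qed
    moreover have "span {u, v} \<subseteq> ?C" using that by (intro span_minimal sub) auto
    ultimately show ?thesis by blast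
  qed
  have combI: "\<exists>s t. z = lie_scale L s u + lie_scale L t v" if "z \<in> span {u, v}" for u v z
  proof -
    from that obtain s where "z - lie_scale L s u \<in> span {v}" by (auto simp: span_breakdown_eq)
    then obtain t where "z - lie_scale L s u = lie_scale L t v" by (auto simp: span_singleton)
    then have "z = lie_scale L s u + lie_scale L t v" by (simp add: algebra_simps)
    then show ?thesis by blast
  qed
  have C_scale: "lie_scale L c u \<in> ?C" if "u \<in> ?C" for c u
    using that sub subspace_scale by blast
  have C_add: "u + v \<in> ?C" if "u \<in> ?C" "v \<in> ?C" for u v
    using that sub subspace_add by blast
  have anti: "lie_bracket L u v = - lie_bracket L v u" if u: "u \<in> ?C" and v: "v \<in> ?C" for u v
  proof -
    have "lie_bracket L (u + v) (u + v) = 0" using u v C_add bracket_alternating by blast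
    moreover have "lie_bracket L (u + v) (u + v) = lie_bracket L u v + lie_bracket L v u"
      using u v bracket_alternating[OF u] bracket_alternating[OF v]
      by (simp add: bracket_add_left bracket_add_right C_add)
    ultimately have "lie_bracket L u v + lie_bracket L v u = 0" by simp
    then show ?thesis by (simp add: eq_neg_iff_add_eq_0)
  qed
  have indep: "independent {u, v} \<and> u \<noteq> v"
    if u: "u \<in> ?C" and v: "v \<in> ?C" and ne: "lie_bracket L u v \<noteq> 0" for u v
  proof -
    have "u \<noteq> v" using ne u bracket_alternating by auto
    have "lie_bracket L 0 v = 0"
      using bracket_scale_left[OF v v, of 0] by simp
    moreover have "lie_bracket L u 0 = 0"
      using bracket_scale_right[OF u u, of 0] by simp
    ultimately have "v \<noteq> 0" "u \<noteq> lie_scale L c v" for c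
      using ne bracket_scale_left[OF v v] bracket_alternating[OF v] by auto
    then have "u \<notin> span {v}" "independent {v}" by (auto simp: span_singleton)
    then show ?thesis using \<open>u \<noteq> v\<close> by (auto simp: independent_insert)
  qed
  obtain u v where u: "u \<in> ?C" and v: "v \<in> ?C" and ne: "lie_bracket L u v \<noteq> 0"
    using nonabelian by blast
  define y where "y = lie_bracket L u v"
  have y: "y \<in> ?C" using u v bracket_closed y_def by blast
  have "y \<in> span {u, v}" using span_pair[OF u v] indep[OF u v ne] y by blast
  then obtain p q where pq: "y = lie_scale L p u + lie_scale L q v" using combI by blast
  have "lie_bracket L u y = lie_bracket L u (lie_scale L p u + lie_scale L q v)"
    using pq by simp
  then have uy: "lie_bracket L u y = lie_scale L q y"
    using u v by (simp add: y_def[symmetric] bracket_add_right bracket_scale_right C_scale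
        bracket_alternating)
  have "lie_bracket L v y = lie_bracket L v (lie_scale L p u + lie_scale L q v)"
    using pq by simp
  then have vy: "lie_bracket L v y = lie_scale L (- p) y"
    using u v anti[OF v u]
    by (simp add: y_def[symmetric] bracket_add_right bracket_scale_right C_scale
        bracket_alternating)
  have y0: "y \<noteq> 0" using ne y_def by simp
  have "\<exists>x\<in>?C. lie_bracket L x y = y"
  proof (cases "q = 0")
    case False
    then show ?thesis
      using u y uy by (intro bexI[of _ "lie_scale L (1 / q) u"])
        (auto simp: bracket_scale_left C_scale)
  next
    case True
    define r where "r = - p"
    have "r \<noteq> 0" using True pq y0 by (auto simp: r_def)
    then show ?thesis
      using v y vy[folded r_def] by (intro bexI[of _ "lie_scale L (1 / r) v"])
        (auto simp: bracket_scale_left C_scale)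
  qed
  then obtain x where x: "x \<in> ?C" and xy: "lie_bracket L x y = y" by blast
  have ind: "independent {x, y}" "x \<noteq> y" using indep[OF x y] xy y0 by auto
  define \<phi> where "\<phi> = (\<lambda>(s, t). lie_scale L s x + lie_scale L t y)"
  have \<phi>C: "\<phi> z \<in> ?C" for z
    using x y by (auto simp: \<phi>_def C_add C_scale split: prod.split)
  have \<phi>diff: "\<phi> a - \<phi> b = \<phi> (a - b)" for a b
    by (auto simp: \<phi>_def scale_left_diff_distrib split: prod.split)
  have ker: "a = 0" if "\<phi> a = 0" for a
  proof -
    obtain s t where a: "a = (s, t)" by (cases a)
    have z: "lie_scale L s x + lie_scale L t y = 0" using that a by (simp add: \<phi>_def)
    have "lie_bracket L (lie_scale L s x + lie_scale L t y) y = lie_scale L s y"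
      using x y by (simp add: bracket_add_left bracket_scale_left C_scale bracket_alternating xy)
    moreover have "lie_bracket L 0 y = 0"
      using bracket_scale_left[OF y y, of 0] by simp
    ultimately have "s = 0" using z y0 by simp
    then show ?thesis using z y0 a by (simp add: zero_prod_def)
  qed
  have "inj \<phi>"
    by (rule injI) (metis \<phi>diff ker eq_iff_diff_eq_0)
  moreover have "range \<phi> = ?C"
  proof
    show "?C \<subseteq> range \<phi>"
    proof
      fix z assume "z \<in> ?C"
      then obtain s t where "z = lie_scale L s x + lie_scale L t y"
        using span_pair[OF x y ind] combI by blast
      then show "z \<in> range \<phi>" by (auto simp: \<phi>_def intro: image_eqI[of _ _ "(s, t)"])
    qed
  qed (use \<phi>C in auto)
  ultimately have "bij_betw \<phi> UNIV ?C" by (simp add: bij_betw_def)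
  moreover have "\<phi> (a + b) = \<phi> a + \<phi> b" for a b
    by (auto simp: \<phi>_def scale_left_distrib split: prod.split)
  moreover have "\<phi> (lie_scale aff1 c a) = lie_scale L c (\<phi> a)" for c a
    by (auto simp: \<phi>_def aff1_def scale_right_distrib split: prod.split)
  moreover have "\<phi> (lie_bracket aff1 a b) = lie_bracket L (\<phi> a) (\<phi> b)" for a b
  proof -
    obtain s t s' t' where ab: "a = (s, t)" "b = (s', t')" by (cases a, cases b)
    have "lie_bracket L (\<phi> a) (\<phi> b) = lie_scale L (s * t') y - lie_scale L (s' * t) y"
      using x y anti[OF y x]
      by (simp add: ab \<phi>_def bracket_add_left bracket_add_right bracket_scale_left
          bracket_scale_right C_scale C_add bracket_alternating xy mult.commute)
    then show ?thesis
      by (simp add: ab aff1_def \<phi>_def scale_left_diff_distrib mult.commute)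
  qed
  ultimately have "lie_iso aff1 L \<phi>" by (simp add: lie_iso_def aff1_def)
  then show ?thesis using L lie_algebra_aff1 by (auto simp: lie_isomorphic_def)
qed

end

(* The coefficient of e_i /\ e_k in the cocycle condition for (e_i, e_j) is w_jk (w_ij + w_ik) = 0; adding
   the cyclic variants gives w_ij w_ik = 0, since 2 is invertible, so each M_alpha is a matching. The
   algebra then splits over the idempotents and, for each alpha, over the edges and the uncovered vertices.
   Brackets satisfy w_ij (f_i + f_j) = 0, and the bracket of two elements with this property vanishes. If
   w_ij is nonzero at alpha, a multiple of ad e_i fixes the alpha component of e_i - e_j. *)

theory Submission
  imports Defs
begin

section \<open>Constructions on Lie algebras\<close>

lemma lie_algebra_restrict_scalars:
  fixes L :: "('k::comm_ring_1, 'a::ab_group_add) lie" and h :: "'l::comm_ring_1 \<Rightarrow> 'k"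
  assumes "lie_algebra L" "h 1 = 1" "\<And>a b. h (a + b) = h a + h b" "\<And>a b. h (a * b) = h a * h b"
  shows "lie_algebra (restrict_scalars h L)"
proof -
  interpret lie_algebra L by fact
  interpret R: module "lie_scale (restrict_scalars h L)"
    by unfold_locales (auto simp: restrict_scalars_def assms scale_right_distrib scale_left_distrib)
  show ?thesis
    using subspace_carrier bracket_closed
    by unfold_locales
      (unfold R.subspace_def subspace_def, auto simp: restrict_scalars_def bracket_add_left
        bracket_add_right bracket_scale_left bracket_scale_right bracket_alternating bracket_jacobi)
qed

lemma lie_algebra_prod:
  assumes "lie_algebra L" "lie_algebra L'"
  shows "lie_algebra (lie_prod L L')"
proof -
  interpret A: lie_algebra L by fact
  interpret B: lie_algebra L' by fact
  interpret P: module "lie_scale (lie_prod L L')"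
    by unfold_locales (auto simp: lie_prod_def A.scale_right_distrib B.scale_right_distrib
        A.scale_left_distrib B.scale_left_distrib)
  show ?thesis
    using A.subspace_carrier B.subspace_carrier A.bracket_closed B.bracket_closed
    by unfold_locales
      (unfold P.subspace_def A.subspace_def B.subspace_def,
        auto simp: lie_prod_def zero_prod_def A.bracket_add_left B.bracket_add_left
        A.bracket_add_right B.bracket_add_right A.bracket_scale_left B.bracket_scale_left
        A.bracket_scale_right B.bracket_scale_right A.bracket_alternating B.bracket_alternating
        A.bracket_jacobi B.bracket_jacobi)
qed

text \<open>The scalar action of \<open>lie_dsum\<close> uses \<open>lie_scale (L i)\<close> at
  every index of the ambient function space, so the summands outside \<open>I\<close> have to
  satisfy the module axioms too.\<close>

lemma lie_algebra_dsum:
  fixes L :: "'i \<Rightarrow> ('k::comm_ring_1, 'a::ab_group_add) lie"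
  assumes "\<And>i. lie_algebra (L i)"
  shows "lie_algebra (lie_dsum I L)"
proof -
  interpret A: lie_algebra "L i" for i by (rule assms)
  interpret P: module "lie_scale (lie_dsum I L)"
    by unfold_locales (auto simp: lie_dsum_def fun_eq_iff A.scale_right_distrib A.scale_left_distrib)
  show ?thesis
    using A.subspace_carrier A.bracket_closed
    by unfold_locales
      (unfold P.subspace_def A.subspace_def,
        auto simp: lie_dsum_def fun_eq_iff A.bracket_add_left A.bracket_add_right
        A.bracket_scale_left A.bracket_scale_right A.bracket_alternating A.bracket_jacobi)
qed

lemma lie_algebra_abelian: "lie_algebra (abelian_lie I :: ('r::comm_ring_1, 'v \<Rightarrow> 'r) lie)"
proof -
  interpret P: module "lie_scale (abelian_lie I :: ('r, 'v \<Rightarrow> 'r) lie)"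
    by unfold_locales
      (auto simp: abelian_lie_def coord_lie_def coord_scale_def fun_eq_iff algebra_simps)
  show ?thesis
    by unfold_locales
      (unfold P.subspace_def, auto simp: abelian_lie_def coord_lie_def coord_module_def coord_scale_def)
qed

section \<open>Composites and direct sums of isomorphisms\<close>

lemma lie_iso_trans:
  assumes "lie_iso L L' \<phi>" "lie_iso L' L'' \<psi>"
  shows "lie_iso L L'' (\<psi> \<circ> \<phi>)"
proof -
  have "\<phi> x \<in> lie_carrier L'" if "x \<in> lie_carrier L" for x
    using assms(1) that by (auto simp: lie_iso_def dest: bij_betwE)
  moreover have "bij_betw (\<psi> \<circ> \<phi>) (lie_carrier L) (lie_carrier L'')"
    using assms by (auto simp: lie_iso_def intro: bij_betw_trans)
  ultimately show ?thesis
    using assms by (simp add: lie_iso_def)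
qed

text \<open>Over \<open>UNIV\<close> no index requires the value zero, so the maps and their
  inverses can be applied index by index.\<close>

lemma lie_iso_dsum_UNIV:
  assumes "\<And>i. lie_iso (L i) (L' i) (\<phi> i)"
  shows "lie_iso (lie_dsum UNIV L) (lie_dsum UNIV L') (\<lambda>f i. \<phi> i (f i))"
proof -
  have bij: "bij_betw (\<phi> i) (lie_carrier (L i)) (lie_carrier (L' i))" for i
    using assms by (auto simp: lie_iso_def)
  have "bij_betw (\<lambda>f i. \<phi> i (f i)) {f. \<forall>i. f i \<in> lie_carrier (L i)} {f. \<forall>i. f i \<in> lie_carrier (L' i)}"
    by (rule bij_betwI[where g = "\<lambda>h i. inv_into (lie_carrier (L i)) (\<phi> i) (h i)"])
      (auto simp: fun_eq_iff bij_betw_inv_into_left[OF bij] bij_betw_inv_into_right[OF bij]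
        bij_betw_apply[OF bij] bij_betw_apply[OF bij_betw_inv_into[OF bij]])
  then show ?thesis
    using assms by (auto simp: lie_iso_def lie_dsum_def fun_eq_iff)
qed

section \<open>Bracket spans and the lower central series\<close>

lemma subset_bracket_span:
  assumes "lie_algebra L" "x \<in> A" "y \<in> B"
  shows "lie_bracket L x y \<in> bracket_span L A B"
proof -
  interpret lie_algebra L by fact
  show ?thesis
    unfolding bracket_span_def using assms by (intro span_base) auto
qed

text \<open>Because \<open>u\<close> is its own bracket with \<open>x\<close>, it survives the
  passage to each next term of the lower central series.\<close>

lemma not_lie_nilpotent_if_ad_fixes:
  assumes "lie_algebra L" "x \<in> lie_carrier L" "u \<in> lie_carrier L" "u \<noteq> 0" "lie_bracket L x u = u"
  shows "\<not> lie_nilpotent L"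
proof -
  have "u \<in> lower_central L n" for n
    using assms subset_bracket_span[OF assms(1,2)] by (induction n) (auto, metis)
  with \<open>u \<noteq> 0\<close> show ?thesis by (auto simp: lie_nilpotent_def)
qed

section \<open>The Lie algebra of a weighted graph\<close>

text \<open>The hypothesis concerns the products, so a term may drop out either through its weight
  or through an antisymmetric factor such as \<open>f i * g i - f i * g i\<close>.\<close>

lemma sum_single_weight:
  fixes u X :: "'v \<Rightarrow> 'r::semiring_0"
  assumes "finite V" "k \<in> V" "\<And>j. j \<in> V \<Longrightarrow> j \<noteq> k \<Longrightarrow> u j * X j = 0"
  shows "(\<Sum>j\<in>V. u j * X j) = u k * X k"
  using assms by (simp add: sum.remove)

text \<open>The bracket has entry \<open>w i l\<close> at \<open>i\<close> and
  \<open>- w l i\<close> at \<open>l\<close>; symmetry merges the two into one coefficient in front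
  of the difference of basis vectors.\<close>

lemma weight_bracket_basis_vec:
  fixes w :: "'v \<Rightarrow> 'v \<Rightarrow> 'r::comm_ring_1"
  assumes "finite V" "i \<in> V" "l \<in> V" "w i l = w l i"
  shows "weight_bracket V w (basis_vec i) (basis_vec l) m =
    w i l * (basis_vec i m - basis_vec l m)"
proof -
  have "weight_bracket V w (basis_vec i) (basis_vec l) m =
     (\<Sum>j\<in>V. if j = l then w m j * basis_vec i m else 0) - (\<Sum>j\<in>V. if j = i then w m j * basis_vec l m else 0)"
    unfolding weight_bracket_def sum_subtractf[symmetric]
    by (rule sum.cong) (auto simp: basis_vec_def algebra_simps)
  also have "\<dots> = w m l * basis_vec i m - w m i * basis_vec l m"
    using assms by simp
  finally show ?thesis
    using assms(4) by (auto simp: basis_vec_def algebra_simps)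
qed

lemma weight_cobracket_basis_vec_entry:
  fixes w :: "'v \<Rightarrow> 'v \<Rightarrow> 'r::comm_ring_1"
  assumes "finite V" "i \<in> V" "a \<in> V" "b \<in> V"
  shows "weight_cobracket V w (basis_vec i) a b = basis_vec i a * w i b - basis_vec i b * w i a"
proof -
  have "weight_cobracket V w (basis_vec i) a b =
     (\<Sum>j\<in>V. (if j = b then w i j * basis_vec i a else 0) - (if j = a then w i j * basis_vec i b else 0))"
    unfolding weight_cobracket_basis_vec[OF assms(1,2)] sum_fun_apply
    by (rule sum.cong) (auto simp: basis_vec_def ext_scale_def wedge_def)
  then show ?thesis
    using assms by (simp add: sum_subtractf algebra_simps)
qed

section \<open>Weight identities from the cocycle condition\<close>

lemma weight_bialgebra_triangle:
  fixes w :: "'v \<Rightarrow> 'v \<Rightarrow> 'r::comm_ring_1"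
  assumes "finite V" and sym: "\<And>i j. i \<in> V \<Longrightarrow> j \<in> V \<Longrightarrow> w i j = w j i"
    and diag: "\<And>i. i \<in> V \<Longrightarrow> w i i = 0"
    and bialg: "lie_bialgebra V (weight_bracket V w) (weight_cobracket V w)"
    and V: "i \<in> V" "j \<in> V" "k \<in> V" and ne: "i \<noteq> j" "i \<noteq> k" "j \<noteq> k"
  shows "w j k * (w i j + w i k) = 0"
proof -
  let ?b = "weight_bracket V w" and ?d = "weight_cobracket V w"
  have in_V: "basis_vec l \<in> coord_module V" if "l \<in> V" for l
    using that by (auto simp: coord_module_def basis_vec_def)
  have add: "?d (x + y) = ?d x + ?d y" if "x \<in> coord_module V" "y \<in> coord_module V" for x y
    using bialg that by (auto simp: lie_bialgebra_def is_cobracket_def)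
  have scale: "?d (coord_scale c x) = ext_scale c (?d x)" if "x \<in> coord_module V" for x c
    using bialg that by (auto simp: lie_bialgebra_def is_cobracket_def)
  have "?d (?b (basis_vec i) (basis_vec j)) =
      ad2 V ?b (basis_vec i) (?d (basis_vec j)) - ad2 V ?b (basis_vec j) (?d (basis_vec i))"
    using bialg in_V V by (auto simp: lie_bialgebra_def)
  then have "?d (?b (basis_vec i) (basis_vec j)) i k =
      ad2 V ?b (basis_vec i) (?d (basis_vec j)) i k - ad2 V ?b (basis_vec j) (?d (basis_vec i)) i k"
    by simp
  moreover have "?d (?b (basis_vec i) (basis_vec j)) i k = w i j * w i k"
  proof -
    \<comment> \<open>The bracket is a combination of two basis vectors, so linearity reduces to
      their cobrackets; the \<open>(i, k)\<close> entry for \<open>basis_vec j\<close> is zero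
      because \<open>j\<close> differs from \<open>i\<close> and \<open>k\<close>.\<close>
    have "?b (basis_vec i) (basis_vec j) =
        coord_scale (w i j) (basis_vec i) + coord_scale (- w i j) (basis_vec j)"
      using assms(1) V sym by (auto simp: fun_eq_iff weight_bracket_basis_vec coord_scale_def algebra_simps)
    then show ?thesis
      using V ne assms(1)
      by (simp add: add scale in_V coord_scale_basis_in ext_scale_def weight_cobracket_basis_vec_entry)
        (simp add: basis_vec_def)
  qed
  moreover have "ad2 V ?b (basis_vec i) (?d (basis_vec j)) i k = w i j * w j k"
  proof -
    \<comment> \<open>Entries of the cobracket of \<open>basis_vec j\<close> live in row or column
      \<open>j\<close>. At \<open>l = j\<close> the row contributes, while the column part is
      multiplied by a bracket entry at \<open>k\<close>, which is zero.\<close>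
    have "ad2 V ?b (basis_vec i) (?d (basis_vec j)) i k =
        (\<Sum>l\<in>V. if l = j then w i j * w j k else 0)"
      unfolding ad2_def using V ne assms(1) sym
      by (intro sum.cong)
        (auto simp: weight_bracket_basis_vec weight_cobracket_basis_vec_entry,
         auto simp: basis_vec_def)
    then show ?thesis using V assms(1) by simp
  qed
  moreover have "ad2 V ?b (basis_vec j) (?d (basis_vec i)) i k = - (w i j * w i k) - w i k * w j k"
  proof -
    \<comment> \<open>The bracket of \<open>basis_vec j\<close> with \<open>basis_vec l\<close>
      reaches position \<open>i\<close> only for \<open>l = i\<close> and position \<open>k\<close>
      only for \<open>l = k\<close>, one case for each summand of \<open>ad2\<close>.\<close>
    have "ad2 V ?b (basis_vec j) (?d (basis_vec i)) i k =
        (\<Sum>l\<in>V. (if l = i then - (w i j * w i k) else 0) - (if l = k then w i k * w j k else 0))"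
      unfolding ad2_def using V ne assms(1) sym diag
      by (intro sum.cong)
        (auto simp: weight_bracket_basis_vec weight_cobracket_basis_vec_entry,
         auto simp: basis_vec_def)
    then show ?thesis using V assms(1) by (simp add: sum_subtractf)
  qed
  ultimately have "w i j * w i k = w i j * w j k - (- (w i j * w i k) - w i k * w j k)" by simp
  then show ?thesis by (simp add: algebra_simps)
qed

lemma weight_bialgebra_product_zero:
  fixes w :: "'v \<Rightarrow> 'v \<Rightarrow> complex ^ 'q::finite"
  assumes "finite V" and sym: "\<And>i j. i \<in> V \<Longrightarrow> j \<in> V \<Longrightarrow> w i j = w j i"
    and "\<And>i. i \<in> V \<Longrightarrow> w i i = 0"
    and "lie_bialgebra V (weight_bracket V w) (weight_cobracket V w)"
    and V: "i \<in> V" "j \<in> V" "k \<in> V" and "j \<noteq> k"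
  shows "w i j * w i k = 0"
proof (cases "i = j \<or> i = k")
  case False
  note T = weight_bialgebra_triangle[OF assms(1-4)]
  have e: "w j k * (w i j + w i k) = 0" "w i k * (w i j + w j k) = 0" "w i j * (w i k + w j k) = 0"
    using T[of i j k] T[of j i k] T[of k i j] False V \<open>j \<noteq> k\<close> sym[of j i] sym[of k i] sym[of k j] by auto
  \<comment> \<open>Adding the second and third identities and subtracting the first cancels every
    product containing \<open>w j k\<close>.\<close>
  have "2 * (w i j * w i k) =
      w i k * (w i j + w j k) + w i j * (w i k + w j k) - w j k * (w i j + w i k)"
    by (simp add: algebra_simps)
  then have "2 * (w i j * w i k) = 0" using e by simp
  \<comment> \<open>The factor 2 is cancelled in each complex component.\<close>
  then show ?thesis by (simp add: vec_eq_iff)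
qed (use assms in auto)

section \<open>The derived algebra\<close>

text \<open>Multiplying by \<open>w i j\<close> removes all neighbours of \<open>i\<close> except
  \<open>j\<close>, and all neighbours of \<open>j\<close> except \<open>i\<close>. What remains at
  the two ends is the same determinant with opposite signs.\<close>

lemma weight_bracket_edge_sum:
  fixes w :: "'v \<Rightarrow> 'v \<Rightarrow> 'r::comm_ring_1"
  assumes "finite V" and sym: "w i j = w j i"
    and prod: "\<And>i j k. i \<in> V \<Longrightarrow> j \<in> V \<Longrightarrow> k \<in> V \<Longrightarrow> j \<noteq> k \<Longrightarrow> w i j * w i k = 0"
    and V: "i \<in> V" "j \<in> V"
  shows "w i j * (weight_bracket V w f g i + weight_bracket V w f g j) = 0"
proof -
  have "w i j * weight_bracket V w f g i = (\<Sum>k\<in>V. (w i j * w i k) * (f i * g k - f k * g i))"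
    by (simp add: weight_bracket_def sum_distrib_left mult.assoc)
  also have "\<dots> = w i j * w i j * (f i * g j - f j * g i)"
    by (rule sum_single_weight[where k = j]) (use assms(1) V prod[of i j] in auto)
  finally have i: "w i j * weight_bracket V w f g i = w i j * w i j * (f i * g j - f j * g i)" .
  have "w j i * weight_bracket V w f g j = (\<Sum>k\<in>V. (w j i * w j k) * (f j * g k - f k * g j))"
    by (simp add: weight_bracket_def sum_distrib_left mult.assoc)
  also have "\<dots> = w j i * w j i * (f j * g i - f i * g j)"
    by (rule sum_single_weight[where k = i]) (use assms(1) V prod[of j i] in auto)
  finally have j: "w j i * weight_bracket V w f g j = w j i * w j i * (f j * g i - f i * g j)" .
  have "w i j * (weight_bracket V w f g i + weight_bracket V w f g j) =
      w i j * weight_bracket V w f g i + w j i * weight_bracket V w f g j"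
    by (simp add: distrib_left sym)
  also have "\<dots> = 0"
    unfolding i j by (simp add: sym algebra_simps)
  finally show ?thesis .
qed

lemma metabelian_complex_weight_lie:
  fixes w :: "'v \<Rightarrow> 'v \<Rightarrow> complex ^ 'q::finite"
  assumes "finite V" and sym: "\<And>i j. i \<in> V \<Longrightarrow> j \<in> V \<Longrightarrow> w i j = w j i"
    and prod: "\<And>i j k. i \<in> V \<Longrightarrow> j \<in> V \<Longrightarrow> k \<in> V \<Longrightarrow> j \<noteq> k \<Longrightarrow> w i j * w i k = 0"
    and L: "lie_algebra (complex_weight_lie V w)"
  shows "metabelian (complex_weight_lie V w)"
proof -
  let ?L = "complex_weight_lie V w"
  interpret lie_algebra ?L by (rule L)
  \<comment> \<open>The edge condition is linear in \<open>f\<close>, so \<open>D\<close> contains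
    the whole span of the brackets as soon as it contains the brackets themselves.\<close>
  define D where "D = {f \<in> coord_module V. \<forall>i\<in>V. \<forall>j\<in>V. w i j * (f i + f j) = 0}"
  have scale: "lie_scale ?L c f = (\<lambda>i. vec c * f i)" for c f
    by (simp add: complex_weight_lie_def restrict_scalars_def coord_lie_def coord_scale_def)
  have br: "lie_bracket ?L = weight_bracket V w" and carrier: "lie_carrier ?L = coord_module V"
    by (simp_all add: complex_weight_lie_def restrict_scalars_def coord_lie_def)
  have "subspace D"
  proof (rule subspaceI)
    show "0 \<in> D" by (simp add: D_def coord_module_def)
  next
    fix f g assume f: "f \<in> D" and g: "g \<in> D"
    have "w i j * (f i + g i + (f j + g j)) = w i j * (f i + f j) + w i j * (g i + g j)" for i j
      by (simp add: algebra_simps)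
    then show "f + g \<in> D" using f g by (auto simp: D_def coord_module_def)
  next
    fix c f assume f: "f \<in> D"
    have "w i j * (vec c * f i + vec c * f j) = vec c * (w i j * (f i + f j))" for i j
      by (simp add: algebra_simps)
    then show "lie_scale ?L c f \<in> D" using f by (auto simp: D_def scale coord_module_def)
  qed
  moreover have "weight_bracket V w f g \<in> D" if "f \<in> coord_module V" "g \<in> coord_module V" for f g
    using bracket_closed[of f g] that weight_bracket_edge_sum[of V w _ _ f g, OF assms(1) sym prod]
    by (auto simp: D_def br carrier)
  ultimately have "derived_algebra ?L \<subseteq> D"
    unfolding derived_algebra_def bracket_span_def by (intro span_minimal) (auto simp: br carrier)
  moreover have "weight_bracket V w f g = 0" if f: "f \<in> D" and g: "g \<in> D" for f g
  proof
    fix i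
    have "w i j * (f i * g j - f j * g i) = 0" if j: "j \<in> V" for j
    proof (cases "i \<in> V")
      case True
      \<comment> \<open>Adding and subtracting \<open>f i * g i\<close> turns the determinant into a
        combination of the two edge conditions defining \<open>D\<close>.\<close>
      have "w i j * (f i * g j - f j * g i) = f i * (w i j * (g i + g j)) - g i * (w i j * (f i + f j))"
        by (simp add: algebra_simps)
      then show ?thesis using f g j True by (simp add: D_def)
    next
      \<comment> \<open>Weights at vertices outside \<open>V\<close> are arbitrary; here the term
        vanishes because \<open>f i\<close> and \<open>g i\<close> do.\<close>
      case False
      then show ?thesis using f g by (simp add: D_def coord_module_def)
    qed
    then show "weight_bracket V w f g i = 0 i" by (simp add: weight_bracket_def)
  qed
  ultimately show ?thesis by (auto simp: metabelian_def br)
qed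

section \<open>Nonnilpotency\<close>

text \<open>The bracket with \<open>basis_vec i\<close> multiplies
  \<open>basis_vec i - basis_vec j\<close> by \<open>- w i j\<close>. In a component where this
  weight is nonzero the factor can be normalised to 1.\<close>

lemma not_lie_nilpotent_complex_weight_lie:
  fixes w :: "'v \<Rightarrow> 'v \<Rightarrow> complex ^ 'q::finite"
  assumes "finite V" and sym: "\<And>i j. i \<in> V \<Longrightarrow> j \<in> V \<Longrightarrow> w i j = w j i"
    and diag: "\<And>i. i \<in> V \<Longrightarrow> w i i = 0"
    and L: "lie_algebra (complex_weight_lie V w)"
    and V: "i \<in> V" "j \<in> V" and "w i j \<noteq> 0"
  shows "\<not> lie_nilpotent (complex_weight_lie V w)"
proof -
  let ?L = "complex_weight_lie V w"
  obtain \<alpha> where \<alpha>: "w i j $ \<alpha> \<noteq> 0" using \<open>w i j \<noteq> 0\<close> by (auto simp: vec_eq_iff)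
  have "i \<noteq> j" using diag V \<open>w i j \<noteq> 0\<close> by auto
  \<comment> \<open>The complex scalar inverts the eigenvalue \<open>- w i j $ \<alpha>\<close>. It
    acts diagonally on all components; the restriction to component \<open>\<alpha>\<close> is built
    into \<open>u\<close>.\<close>
  define x :: "'v \<Rightarrow> complex ^ 'q" where "x = coord_scale (vec (- 1 / w i j $ \<alpha>)) (basis_vec i)"
  define u :: "'v \<Rightarrow> complex ^ 'q" where "u = (\<lambda>m. axis \<alpha> 1 * (basis_vec i m - basis_vec j m))"
  have carrier: "lie_carrier ?L = coord_module V" and br: "lie_bracket ?L = weight_bracket V w"
    by (simp_all add: complex_weight_lie_def restrict_scalars_def coord_lie_def)
  have x: "x \<in> lie_carrier ?L"
    unfolding x_def carrier by (rule coord_scale_basis_in[OF V(1)])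
  have u: "u \<in> lie_carrier ?L" using V by (auto simp: carrier u_def coord_module_def basis_vec_def)
  have "u i \<noteq> 0" using \<open>i \<noteq> j\<close> by (simp add: u_def basis_vec_def)
  then have "u \<noteq> 0" by auto
  have "weight_bracket V w x u = u"
  proof
    fix m
    let ?c = "vec (- 1 / w i j $ \<alpha>) * axis \<alpha> 1 :: complex ^ 'q"
    have "weight_bracket V w x u m = ?c * (weight_bracket V w (basis_vec i) (basis_vec i) m
         - weight_bracket V w (basis_vec i) (basis_vec j) m)"
      unfolding weight_bracket_def sum_subtractf[symmetric] sum_distrib_left
      by (rule sum.cong) (auto simp: x_def u_def coord_scale_def algebra_simps)
    also have "\<dots> = - (?c * w i j) * (basis_vec i m - basis_vec j m)"
      using assms(1) V sym[OF V] by (simp add: weight_bracket_basis_vec mult.assoc)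
    \<comment> \<open>The idempotent deletes the other components of \<open>w i j\<close>, and at
      \<open>\<alpha>\<close> the scalar is its negative inverse.\<close>
    also have "- (?c * w i j) = axis \<alpha> 1"
      using \<alpha> by (auto simp: vec_eq_iff axis_def)
    finally show "weight_bracket V w x u m = u m" by (simp add: u_def)
  qed
  then show ?thesis
    using not_lie_nilpotent_if_ad_fixes[OF L x u \<open>u \<noteq> 0\<close>] by (simp add: br)
qed

section \<open>Complex dimension\<close>

lemma lie_dim_complex_weight_lie:
  fixes w :: "'v \<Rightarrow> 'v \<Rightarrow> complex ^ 'q::finite"
  assumes "finite V" and L: "lie_algebra (complex_weight_lie V w)"
  shows "lie_dim (complex_weight_lie V w) = CARD('q) * card V"
proof -
  let ?L = "complex_weight_lie V w"
  interpret vector_space "lie_scale ?L" by (rule vector_space_lie_algebra[OF L])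
  have scale: "lie_scale ?L c f = (\<lambda>i. vec c * f i)" for c f
    by (simp add: complex_weight_lie_def restrict_scalars_def coord_lie_def coord_scale_def)
  have carrier: "lie_carrier ?L = coord_module V"
    by (simp add: complex_weight_lie_def restrict_scalars_def coord_lie_def)
  \<comment> \<open>The primitive idempotents are a complex basis of the ring, so their multiples of
    the coordinate vectors form a complex basis of the free module.\<close>
  define b :: "'q \<times> 'v \<Rightarrow> 'v \<Rightarrow> complex ^ 'q"
    where "b = (\<lambda>(\<alpha>, k). coord_scale (axis \<alpha> 1) (basis_vec k))"
  have b: "b (\<alpha>, k) i $ \<beta> = (if k = i \<and> \<alpha> = \<beta> then 1 else 0)" for \<alpha> k i \<beta>
    by (auto simp: b_def coord_scale_def basis_vec_def axis_def)
  have inj: "inj b"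
  proof (rule injI)
    fix p p' assume "b p = b p'"
    then have "b p (snd p) $ fst p = b p' (snd p) $ fst p" by simp
    then show "p = p'" by (cases p, cases p') (auto simp: b split: if_splits)
  qed
  let ?B = "b ` (UNIV \<times> V)"
  have "?B \<subseteq> coord_module V"
    by (auto simp: b_def intro!: coord_scale_basis_in)
  moreover have "coord_module V \<subseteq> span ?B"
  proof
    fix f :: "'v \<Rightarrow> complex ^ 'q" assume f: "f \<in> coord_module V"
    have "f = (\<Sum>p\<in>UNIV \<times> V. lie_scale ?L (f (snd p) $ fst p) (b p))"
    proof (rule ext, rule vec_eq_iff[THEN iffD2], rule allI)
      fix i \<beta>
      have "(\<Sum>p\<in>UNIV \<times> V. lie_scale ?L (f (snd p) $ fst p) (b p)) i $ \<beta> =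
          (\<Sum>p\<in>UNIV \<times> V. if p = (\<beta>, i) then f i $ \<beta> else 0)"
        unfolding sum_fun_apply sum_component
        by (rule sum.cong) (auto simp: scale b split: if_splits)
      then show "f i $ \<beta> = (\<Sum>p\<in>UNIV \<times> V. lie_scale ?L (f (snd p) $ fst p) (b p)) i $ \<beta>"
        using f assms(1) by (auto simp: coord_module_def)
    qed
    moreover have "(\<Sum>p\<in>UNIV \<times> V. lie_scale ?L (f (snd p) $ fst p) (b p)) \<in> span ?B"
      by (intro span_sum span_scale span_base) auto
    ultimately show "f \<in> span ?B" by simp
  qed
  moreover have "independent ?B"
    unfolding dependent_def
  proof clarify
    fix \<alpha> k assume s: "b (\<alpha>, k) \<in> span (?B - {b (\<alpha>, k)})"
    \<comment> \<open>This coordinate hyperplane contains every other basis element, hence their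
      span, but \<open>b (\<alpha>, k)\<close> has coordinate 1 there.\<close>
    let ?S = "{f :: 'v \<Rightarrow> complex ^ 'q. f k $ \<alpha> = 0}"
    have "subspace ?S" by (rule subspaceI) (auto simp: scale)
    moreover have "?B - {b (\<alpha>, k)} \<subseteq> ?S" by (auto simp: b)
    ultimately have "b (\<alpha>, k) \<in> ?S" using s span_minimal by blast
    then show False by (simp add: b)
  qed
  moreover have "card ?B = CARD('q) * card V"
    using inj by (simp add: card_image inj_on_subset card_cartesian_product)
  ultimately show ?thesis
    by (simp add: lie_dim_def carrier dim_unique)
qed

section \<open>Decomposition along matchings\<close>

text \<open>Two distinct edges at a vertex \<open>i\<close> would have weights that are both nonzero
  at \<open>\<alpha>\<close>, although their product is zero and the component is a field. The zero
  diagonal excludes loops.\<close>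

lemma matching_support_edges:
  fixes w :: "'v \<Rightarrow> 'v \<Rightarrow> complex ^ 'q::finite"
  assumes sym: "\<And>i j. i \<in> V \<Longrightarrow> j \<in> V \<Longrightarrow> w i j = w j i"
    and diag: "\<And>i. i \<in> V \<Longrightarrow> w i i = 0"
    and prod: "\<And>i j k. i \<in> V \<Longrightarrow> j \<in> V \<Longrightarrow> k \<in> V \<Longrightarrow> j \<noteq> k \<Longrightarrow> w i j * w i k = 0"
  shows "is_matching (support_edges V w \<alpha>)"
  unfolding is_matching_def
proof
  let ?M = "support_edges V w \<alpha>"
  have "i \<noteq> j" if "i \<in> V" "w i j $ \<alpha> \<noteq> 0" for i j
    using diag that by auto
  then show "\<forall>e\<in>?M. card e = 2"
    unfolding support_edges_def by fastforce
  \<comment> \<open>Symmetry of the weights allows any chosen vertex of an edge to be listed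
    first.\<close>
  have edge: "\<exists>j\<in>V. i \<in> V \<and> e = {i, j} \<and> w i j $ \<alpha> \<noteq> 0" if "e \<in> ?M" "i \<in> e" for e i
    using that sym unfolding support_edges_def by (auto simp: insert_commute)
  show "pairwise disjnt ?M"
  proof (rule pairwiseI, rule ccontr)
    fix e e' assume e: "e \<in> ?M" "e' \<in> ?M" "e \<noteq> e'" and "\<not> disjnt e e'"
    then obtain i where i: "i \<in> e" "i \<in> e'" by (auto simp: disjnt_iff)
    obtain j k where jk: "j \<in> V" "k \<in> V" "i \<in> V" "e = {i, j}" "e' = {i, k}" "w i j $ \<alpha> \<noteq> 0" "w i k $ \<alpha> \<noteq> 0"
      using edge[OF e(1) i(1)] edge[OF e(2) i(2)] by auto
    then have "j \<noteq> k" using e by auto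
    then have "(w i j * w i k) $ \<alpha> = 0" using prod[of i j k] jk by simp
    then show False using jk by simp
  qed
qed

text \<open>Disjoint edges with two vertices each cover \<open>2 * card M\<close> vertices.\<close>

lemma card_matching:
  assumes "finite V" "is_matching M" "\<Union>M \<subseteq> V"
  shows "2 * card M + card (V - \<Union>M) = card V"
proof -
  have fin: "finite (\<Union>M)" by (rule finite_subset[OF assms(3,1)])
  have "finite e" if "e \<in> M" for e
    using finite_subset[OF Union_upper[OF that] fin] .
  then have "card (\<Union>M) = sum card M"
    using assms(2) by (intro card_Union_disjoint) (simp_all add: is_matching_def)
  also have "\<dots> = 2 * card M" using assms(2) by (simp add: is_matching_def)
  finally show ?thesis
    using card_Diff_subset[OF fin assms(3)] card_mono[OF assms(1,3)] by simp
qed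

text \<open>On an edge \<open>{r, s}\<close> of weight \<open>g\<close> the bracket is \<open>g (f\<^sub>r f'\<^sub>s - f\<^sub>s f'\<^sub>r) (e\<^sub>r - e\<^sub>s)\<close>, so
  \<open>- g (f\<^sub>r + f\<^sub>s)\<close> and \<open>f\<^sub>r\<close> are the two coordinates in \<open>aff1\<close>.\<close>

lemma matching_lie_iso:
  fixes \<gamma> :: "'v \<Rightarrow> 'v \<Rightarrow> complex"
  assumes "finite V" and sym: "\<And>i j. i \<in> V \<Longrightarrow> j \<in> V \<Longrightarrow> \<gamma> i j = \<gamma> j i"
    and M: "M = {{i, j} |i j. i \<in> V \<and> j \<in> V \<and> \<gamma> i j \<noteq> 0}" and "is_matching M"
  shows "\<exists>\<phi>. lie_iso (coord_lie V (weight_bracket V \<gamma>))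
    (lie_prod (lie_dsum M (\<lambda>e. aff1)) (abelian_lie (V - \<Union>M))) \<phi>"
proof -
  have "\<forall>e\<in>M. \<exists>i j. e = {i, j} \<and> i \<in> V \<and> j \<in> V \<and> \<gamma> i j \<noteq> 0" by (auto simp: M)
  \<comment> \<open>An orientation of every edge is fixed here; the second \<open>aff1\<close>
    coordinate of \<open>\<phi>\<close> depends on it.\<close>
  then obtain r s where ends: "\<And>e. e \<in> M \<Longrightarrow> e = {r e, s e}"
    and rs: "\<And>e. e \<in> M \<Longrightarrow> r e \<in> V \<and> s e \<in> V \<and> \<gamma> (r e) (s e) \<noteq> 0"
    by metis
  have mem: "i \<in> e \<longleftrightarrow> i = r e \<or> i = s e" if "e \<in> M" for e i
    using ends[OF that] by (metis insert_iff singletonD)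
  have uniq: "e = e'" if "e \<in> M" "e' \<in> M" "i \<in> e" "i \<in> e'" for e e' i
    using that assms(4) by (auto simp: is_matching_def pairwise_def disjnt_iff)
  \<comment> \<open>Members of a matching have two elements, which rules out loops of nonzero
    weight.\<close>
  have ne: "r e \<noteq> s e" if "e \<in> M" for e
  proof
    assume "r e = s e"
    moreover have "card {r e, s e} = 2"
      using assms(4) that ends[OF that] by (metis is_matching_def)
    ultimately show False by simp
  qed
  have sym_rs: "\<gamma> (s e) (r e) = \<gamma> (r e) (s e)" if "e \<in> M" for e
    using rs[OF that] sym by blast
  have edge: "{i, j} \<in> M" if "i \<in> V" "j \<in> V" "\<gamma> i j \<noteq> 0" for i j
    using that M by blast
  have br_r: "weight_bracket V \<gamma> f g (r e) = \<gamma> (r e) (s e) * (f (r e) * g (s e) - f (s e) * g (r e))"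
    and br_s: "weight_bracket V \<gamma> f g (s e) = - \<gamma> (r e) (s e) * (f (r e) * g (s e) - f (s e) * g (r e))"
    if e: "e \<in> M" for e f g
  proof -
    \<comment> \<open>A nonzero weight leading out of \<open>e\<close> would give a second edge at
      an endpoint of \<open>e\<close>. The bracket sum at one end thus reduces to the other end, the
      diagonal term being zero by antisymmetry.\<close>
    have z: "\<gamma> i k = 0" if "i \<in> e" "k \<in> V" "k \<notin> e" for i k
    proof (rule ccontr)
      assume "\<gamma> i k \<noteq> 0"
      moreover have "i \<in> V" using that(1) rs[OF e] mem[OF e] by metis
      ultimately have "e = {i, k}" using uniq[OF e edge[of i k], of i] that by blast
      then show False using that(3) by blast
    qed
    have "weight_bracket V \<gamma> f g (r e) = \<gamma> (r e) (s e) * (f (r e) * g (s e) - f (s e) * g (r e))"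
      unfolding weight_bracket_def
      by (rule sum_single_weight[where k = "s e"]) (use rs[OF e] z[of "r e"] mem[OF e] assms(1) in auto)
    then show "weight_bracket V \<gamma> f g (r e) = \<gamma> (r e) (s e) * (f (r e) * g (s e) - f (s e) * g (r e))" .
    have "weight_bracket V \<gamma> f g (s e) = \<gamma> (s e) (r e) * (f (s e) * g (r e) - f (r e) * g (s e))"
      unfolding weight_bracket_def
      by (rule sum_single_weight[where k = "r e"]) (use rs[OF e] z[of "s e"] mem[OF e] assms(1) in auto)
    then show "weight_bracket V \<gamma> f g (s e) = - \<gamma> (r e) (s e) * (f (r e) * g (s e) - f (s e) * g (r e))"
      by (simp add: sym_rs[OF e] algebra_simps)
  qed
  have br_0: "weight_bracket V \<gamma> f g i = 0" if "i \<in> V - \<Union>M" for f g i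
  proof -
    have "\<gamma> i j * (f i * g j - f j * g i) = 0" if "j \<in> V" for j
      using edge[of i j] that \<open>i \<in> V - \<Union>M\<close> by (cases "\<gamma> i j = 0") auto
    then show ?thesis unfolding weight_bracket_def by (intro sum.neutral) blast
  qed
  define a :: "('v \<Rightarrow> complex) \<Rightarrow> 'v set \<Rightarrow> complex"
    where "a f e = - \<gamma> (r e) (s e) * (f (r e) + f (s e))" for f e
  define \<phi> :: "('v \<Rightarrow> complex) \<Rightarrow> ('v set \<Rightarrow> complex \<times> complex) \<times> ('v \<Rightarrow> complex)"
    where "\<phi> f = ((\<lambda>e. if e \<in> M then (a f e, f (r e)) else 0),
      (\<lambda>i. if i \<in> V - \<Union>M then f i else 0))" for f
  \<comment> \<open>The edge through a covered vertex; the value is used at covered vertices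
    only.\<close>
  define \<epsilon> where "\<epsilon> i = (THE e. e \<in> M \<and> i \<in> e)" for i
  have \<epsilon>: "\<epsilon> i = e" if "e \<in> M" "i \<in> e" for i e
    unfolding \<epsilon>_def by (rule the_equality) (use that uniq in metis)+
  \<comment> \<open>The inverse of \<open>\<phi>\<close>: the value at \<open>r e\<close> is the
    second \<open>aff1\<close> coordinate, and solving the equation for \<open>a f e\<close> gives
    the value at \<open>s e\<close>, with division by a nonzero weight.\<close>
  define \<psi> :: "('v set \<Rightarrow> complex \<times> complex) \<times> ('v \<Rightarrow> complex) \<Rightarrow> 'v \<Rightarrow> complex"
    where "\<psi> h i = (if i \<notin> V then 0 else if i \<notin> \<Union>M then snd h i
      else if i = r (\<epsilon> i) then snd (fst h (\<epsilon> i))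
      else - fst (fst h (\<epsilon> i)) / \<gamma> (r (\<epsilon> i)) (s (\<epsilon> i)) - snd (fst h (\<epsilon> i)))" for h i
  let ?L = "coord_lie V (weight_bracket V \<gamma>)"
  let ?L' = "lie_prod (lie_dsum M (\<lambda>e. aff1)) (abelian_lie (V - \<Union>M)) ::
    (complex, ('v set \<Rightarrow> complex \<times> complex) \<times> ('v \<Rightarrow> complex)) lie"
  have inM: "r e \<in> \<Union>M" "s e \<in> \<Union>M" "\<epsilon> (r e) = e" "\<epsilon> (s e) = e" if "e \<in> M" for e
    using that mem[OF that] \<epsilon>[OF that] by blast+
  have "bij_betw \<phi> (lie_carrier ?L) (lie_carrier ?L')"
  proof (rule bij_betwI[where g = \<psi>])
    show "\<phi> \<in> lie_carrier ?L \<rightarrow> lie_carrier ?L'"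
      by (auto simp: \<phi>_def coord_lie_def lie_prod_def lie_dsum_def aff1_def abelian_lie_def coord_module_def)
    show "\<psi> \<in> lie_carrier ?L' \<rightarrow> lie_carrier ?L"
      by (auto simp: \<psi>_def coord_lie_def coord_module_def)
    show "\<psi> (\<phi> f) = f" if "f \<in> lie_carrier ?L" for f
    proof
      fix i
      consider "i \<notin> V" | "i \<in> V" "i \<notin> \<Union>M" | e where "i \<in> V" "e \<in> M" "i \<in> e" by blast
      then show "\<psi> (\<phi> f) i = f i"
      proof cases
        case 3
        then have "i = r e \<or> i = s e" using mem by blast
        then show ?thesis
          using 3 rs[OF 3(2)] inM[OF 3(2)] ne[OF 3(2)] by (auto simp: \<psi>_def \<phi>_def a_def)
      qed (use that in \<open>auto simp: \<psi>_def \<phi>_def coord_lie_def coord_module_def\<close>)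
    qed
    show "\<phi> (\<psi> h) = h" if "h \<in> lie_carrier ?L'" for h
    proof (rule prod_eqI; rule ext)
      fix e show "fst (\<phi> (\<psi> h)) e = fst h e"
      proof (cases "e \<in> M")
        case True
        have "\<psi> h (r e) = snd (fst h e)"
          "\<psi> h (s e) = - fst (fst h e) / \<gamma> (r e) (s e) - snd (fst h e)"
          using rs[OF True] inM[OF True] ne[OF True] by (auto simp: \<psi>_def)
        then show ?thesis using True rs[OF True] by (simp add: \<phi>_def a_def)
      next
        case False
        then show ?thesis
          using that by (auto simp: \<phi>_def lie_prod_def lie_dsum_def)
      qed
    next
      fix i show "snd (\<phi> (\<psi> h)) i = snd h i"
        using that by (auto simp: \<phi>_def \<psi>_def lie_prod_def abelian_lie_def coord_lie_def coord_module_def)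
    qed
  qed
  moreover have "\<phi> (f + g) = \<phi> f + \<phi> g" for f g
    by (auto simp: \<phi>_def a_def fun_eq_iff algebra_simps)
  moreover have "\<phi> (lie_scale ?L c f) = lie_scale ?L' c (\<phi> f)" for c f
    by (auto simp: \<phi>_def a_def fun_eq_iff coord_lie_def coord_scale_def lie_prod_def lie_dsum_def
        aff1_def abelian_lie_def zero_prod_def algebra_simps)
  moreover have "\<phi> (lie_bracket ?L f g) = lie_bracket ?L' (\<phi> f) (\<phi> g)" for f g
  proof -
    \<comment> \<open>The bracket has opposite values at the two ends, so their sum vanishes,
      matching the zero first coordinate of an \<open>aff1\<close> bracket. In the second coordinate
      the products \<open>f (r e) * g (r e)\<close> cancel.\<close>
    have "a (weight_bracket V \<gamma> f g) e = 0" if "e \<in> M" for e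
      by (simp add: a_def br_r[OF that] br_s[OF that])
    moreover have "weight_bracket V \<gamma> f g (r e) = a f e * g (r e) - f (r e) * a g e" if "e \<in> M" for e
      by (simp add: a_def br_r[OF that] algebra_simps)
    ultimately show ?thesis
      using br_0[of _ f g]
      by (auto simp: \<phi>_def fun_eq_iff coord_lie_def lie_prod_def lie_dsum_def aff1_def abelian_lie_def)
  qed
  ultimately show ?thesis unfolding lie_iso_def by blast
qed

section \<open>Splitting over the idempotents and assembly\<close>

text \<open>Multiplication in the ring is componentwise and \<open>vec c\<close> has every component
  equal to \<open>c\<close>, so taking components respects both bracket and complex scalars.\<close>

lemma complex_weight_lie_iso_components:
  fixes w :: "'v \<Rightarrow> 'v \<Rightarrow> complex ^ 'q::finite"
  shows "lie_iso (complex_weight_lie V w)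
    (lie_dsum UNIV (\<lambda>\<alpha>. coord_lie V (weight_bracket V (\<lambda>i j. w i j $ \<alpha>)))) (\<lambda>f \<alpha> i. f i $ \<alpha>)"
proof -
  have "bij_betw (\<lambda>f \<alpha> i. f i $ \<alpha>) (coord_module V :: ('v \<Rightarrow> complex ^ 'q) set)
      {h. \<forall>\<alpha>. h \<alpha> \<in> coord_module V}"
    by (rule bij_betwI[where g = "\<lambda>h i. \<chi> \<alpha>. h \<alpha> i"])
      (auto simp: coord_module_def vec_eq_iff fun_eq_iff)
  then show ?thesis
    by (auto simp: lie_iso_def complex_weight_lie_def restrict_scalars_def coord_lie_def lie_dsum_def
        coord_scale_def weight_bracket_def fun_eq_iff)
qed

theorem theorem3p6:
  fixes V :: "'v set" and w :: "'v \<Rightarrow> 'v \<Rightarrow> complex ^ 'q::finite"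
  assumes "finite V"
    and "\<And>i j. i \<in> V \<Longrightarrow> j \<in> V \<Longrightarrow> w i j = w j i"
    and "\<And>i. i \<in> V \<Longrightarrow> w i i = 0"
    and "lie_bialgebra V (weight_bracket V w) (weight_cobracket V w)"
  shows "(\<forall>\<alpha>. is_matching (support_edges V w \<alpha>)) \<and>
    lie_isomorphic (complex_weight_lie V w)
      (lie_dsum UNIV (\<lambda>\<alpha>. lie_prod (lie_dsum (support_edges V w \<alpha>) (\<lambda>e. aff1))
                                  (abelian_lie (uncovered V w \<alpha>)))) \<and>
    lie_dim (complex_weight_lie V w) =
      (\<Sum>\<alpha>\<in>UNIV. 2 * card (support_edges V w \<alpha>) + card (uncovered V w \<alpha>)) \<and>
    lie_dim (complex_weight_lie V w) = CARD('q) * card V \<and>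
    metabelian (complex_weight_lie V w) \<and>
    ((\<exists>i\<in>V. \<exists>j\<in>V. w i j \<noteq> 0) \<longrightarrow> \<not> lie_nilpotent (complex_weight_lie V w))"
proof -
  note prod = weight_bialgebra_product_zero[OF assms]
  let ?L = "complex_weight_lie V w" and ?M = "support_edges V w"
  let ?L' = "lie_dsum UNIV (\<lambda>\<alpha>. lie_prod (lie_dsum (?M \<alpha>) (\<lambda>e. aff1)) (abelian_lie (uncovered V w \<alpha>)))"
  have M: "is_matching (?M \<alpha>)" for \<alpha>
    by (rule matching_support_edges[OF assms(2,3) prod])
  have L: "lie_algebra ?L"
    unfolding complex_weight_lie_def
    \<comment> \<open>The diagonal embedding is a unital ring homomorphism, and the Lie axioms over
      the large ring are part of the bialgebra hypothesis.\<close>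
    by (rule lie_algebra_restrict_scalars)
      (use assms(4) in \<open>auto simp: lie_bialgebra_def vec_eq_iff\<close>)
  have L': "lie_algebra ?L'"
    by (intro lie_algebra_dsum lie_algebra_prod lie_algebra_aff1 lie_algebra_abelian)
  have "\<exists>\<phi>. lie_iso (coord_lie V (weight_bracket V (\<lambda>i j. w i j $ \<alpha>)))
      (lie_prod (lie_dsum (?M \<alpha>) (\<lambda>e. aff1)) (abelian_lie (uncovered V w \<alpha>))) \<phi>" for \<alpha>
    unfolding uncovered_def
    by (rule matching_lie_iso) (use assms(1,2) M in \<open>auto simp: support_edges_def\<close>)
  then obtain \<phi> where "lie_iso (coord_lie V (weight_bracket V (\<lambda>i j. w i j $ \<alpha>)))
      (lie_prod (lie_dsum (?M \<alpha>) (\<lambda>e. aff1)) (abelian_lie (uncovered V w \<alpha>))) (\<phi> \<alpha>)" for \<alpha>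
    by metis
  from lie_iso_trans[OF complex_weight_lie_iso_components lie_iso_dsum_UNIV[OF this]]
  have "lie_isomorphic ?L ?L'" using L L' by (auto simp: lie_isomorphic_def)
  moreover have "lie_dim ?L = CARD('q) * card V"
    by (rule lie_dim_complex_weight_lie[OF assms(1) L])
  \<comment> \<open>Each idempotent contributes \<open>card V\<close>, so the sum over the matchings
    equals the dimension \<open>CARD('q) * card V\<close>.\<close>
  moreover have "2 * card (?M \<alpha>) + card (uncovered V w \<alpha>) = card V" for \<alpha>
    unfolding uncovered_def
    by (rule card_matching[OF assms(1) M]) (auto simp: support_edges_def)
  moreover have "metabelian ?L"
    by (rule metabelian_complex_weight_lie[OF assms(1,2) prod L])
  moreover have "\<not> lie_nilpotent ?L" if "\<exists>i\<in>V. \<exists>j\<in>V. w i j \<noteq> 0"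
    using that not_lie_nilpotent_complex_weight_lie[OF assms(1-3) L] by blast
  ultimately show ?thesis using M by simp
qed

end
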